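(* Let $\mathcal{G}:\mathbb{R}^{N_\theta}\to\mathbb{R}^{N_y}$ with $N_\theta=N_y$ be a bijection with Jacobian $d\mathcal{G}$, let $y\in\mathbb{R}^{N_y}$, and let $\Sigma_\eta\succ0$ be an $N_y\times N_y$ covariance matrix. Let $m_*,C_*$ be any stationary mean and covariance (i.e. fixed point) of the extended Kalman inversion (ExKI) iteration defined in the context, such that both $d\mathcal{G}(m_* )$ and $C_*$ are non-singular. Then $$m_*=\mathcal{G}^{-1}(y)\qquad\text{and}\qquad C_*^{-1}=d\mathcal{G}(m_* )^T\,\Sigma_\eta^{-1}\,d\mathcal{G}(m_* ).$$ Moreover, $m_*$ and $C_*$ are the mean and covariance estimates, obtained by the extended Kalman filter, of the pull-back random variable $\theta^\eta=\mathcal{G}^{-1}(y-\eta)$, where $\eta\sim\mathcal{N}(0,\Sigma_\eta)$.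
   Context: The ExKI iteration, with hyperparameters $\Sigma_\nu=2\Sigma_\eta$ and $\Sigma_\omega=C_n$ at the $n$-th iteration, maps $(m_n,C_n)$ to $(m_{n+1},C_{n+1})$ as follows. Prediction: $\widehat m_{n+1}=m_n$, $\widehat C_{n+1}=C_n+\Sigma_\omega=2C_n$. Analysis: $$\widehat y_{n+1}=\mathcal{G}(\widehat m_{n+1}),\quad \widehat C^{\theta p}_{n+1}=\widehat C_{n+1}\,d\mathcal{G}(\widehat m_{n+1})^T,\quad \widehat C^{pp}_{n+1}=d\mathcal{G}(\widehat m_{n+1})\,\widehat C_{n+1}\,d\mathcal{G}(\widehat m_{n+1})^T+\Sigma_\nu,$$ $$m_{n+1}=\widehat m_{n+1}+\widehat C^{\theta p}_{n+1}(\widehat C^{pp}_{n+1})^{-1}(y-\widehat y_{n+1}),\qquad C_{n+1}=\widehat C_{n+1}-\widehat C^{\theta p}_{n+1}(\widehat C^{pp}_{n+1})^{-1}(\widehat C^{\theta p}_{n+1})^T.$$ A stationary mean and covariance $(m_*,C_* )$ is a pair, with $C_*$ a covariance matrix, that is fixed by this map. The extended Kalman filter estimates of the mean and covariance of $\theta^\eta=\mathcal{G}^{-1}(y-\eta)$ are, by definition, those obtained by first-order linearization: the mean estimate is $\mathcal{G}^{-1}(y-\mathbb{E}\eta)=\mathcal{G}^{-1}(y)$ and the covariance estimate is $d\mathcal{G}^{-1}(y)\,\mathrm{Cov}[\eta]\,d\mathcal{G}^{-1}(y)^T=d\mathcal{G}^{-1}(y)\,\Sigma_\eta\,d\mathcal{G}^{-1}(y)^T$,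 where $d\mathcal{G}^{-1}(y)$ is the Jacobian of $\mathcal{G}^{-1}$ at $y$ (differentiability of $\mathcal{G}$ and $\mathcal{G}^{-1}$ where these are written is implicit). *)

theory Defs
  imports "HOL-Probability.Probability"
begin

definition covariance_matrix :: "real^'n^'n \<Rightarrow> bool" where
  "covariance_matrix C \<longleftrightarrow> transpose C = C \<and> (\<forall>x. 0 \<le> x \<bullet> (C *v x))"

definition positive_definite :: "real^'n^'n \<Rightarrow> bool" where
  "positive_definite C \<longleftrightarrow> transpose C = C \<and> (\<forall>x. x \<noteq> 0 \<longrightarrow> 0 < x \<bullet> (C *v x))"

text \<open>One step of the extended Kalman filter for the artificial dynamics
  \<open>\<theta>\<^sub>n\<^sub>+\<^sub>1 = \<theta>\<^sub>n + \<omega>\<close>, \<open>y = G \<theta>\<^sub>n\<^sub>+\<^sub>1 + \<nu>\<close> with noise covariances \<open>S\<^sub>\<omega>\<close> and \<open>S\<^sub>\<nu>\<close>.\<close>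

definition ekf_step ::
  "(real^'n \<Rightarrow> real^'m) \<Rightarrow> real^'m \<Rightarrow> real^'n^'n \<Rightarrow> real^'m^'m
    \<Rightarrow> (real^'n) \<times> (real^'n^'n) \<Rightarrow> (real^'n) \<times> (real^'n^'n)" where
  "ekf_step G y S\<^sub>\<omega> S\<^sub>\<nu> = (\<lambda>(m, C).
     let m' = m;
         C' = C + S\<^sub>\<omega>;
         y' = G m';
         dG = jacobian G (at m');
         Ctp = C' ** transpose dG;
         Cpp = dG ** C' ** transpose dG + S\<^sub>\<nu>
     in (m' + (Ctp ** matrix_inv Cpp) *v (y - y'),
         C' - Ctp ** matrix_inv Cpp ** transpose Ctp))"

text \<open>The process-noise covariance is the current covariance, hence depends on the iterate.\<close>

definition exki_step ::
  "(real^'n \<Rightarrow> real^'m) \<Rightarrow> real^'m \<Rightarrow> real^'m^'m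
    \<Rightarrow> (real^'n) \<times> (real^'n^'n) \<Rightarrow> (real^'n) \<times> (real^'n^'n)" where
  "exki_step G y S\<^sub>\<eta> = (\<lambda>(m, C). ekf_step G y C (2 *\<^sub>R S\<^sub>\<eta>) (m, C))"

definition exki_stationary ::
  "(real^'n \<Rightarrow> real^'m) \<Rightarrow> real^'m \<Rightarrow> real^'m^'m \<Rightarrow> real^'n \<Rightarrow> real^'n^'n \<Rightarrow> bool" where
  "exki_stationary G y S\<^sub>\<eta> m C \<longleftrightarrow>
     covariance_matrix C \<and> exki_step G y S\<^sub>\<eta> (m, C) = (m, C)"

definition covariance :: "'a measure \<Rightarrow> ('a \<Rightarrow> real^'n) \<Rightarrow> real^'n^'n" where
  "covariance M X = (\<chi> i j. \<integral>\<omega>. (X \<omega> - integral\<^sup>L M X) $ i * (X \<omega> - integral\<^sup>L M X) $ j \<partial>M)"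

definition multivariate_normal_density :: "real^'n \<Rightarrow> real^'n^'n \<Rightarrow> real^'n \<Rightarrow> real" where
  "multivariate_normal_density \<mu> S x =
     exp (- ((x - \<mu>) \<bullet> (matrix_inv S *v (x - \<mu>))) / 2) / sqrt ((2 * pi) ^ CARD('n) * det S)"

text \<open>Only the non-degenerate case, where a Lebesgue density exists.\<close>

definition multivariate_normal ::
  "'a measure \<Rightarrow> ('a \<Rightarrow> real^'n) \<Rightarrow> real^'n \<Rightarrow> real^'n^'n \<Rightarrow> bool" where
  "multivariate_normal M X \<mu> S \<longleftrightarrow> prob_space M \<and> positive_definite S \<and>
     distributed M lborel X (\<lambda>x. ennreal (multivariate_normal_density \<mu> S x))"

text \<open>Extended Kalman filter estimates of the mean and covariance of the pull-back
  \<open>inv G (y - \<eta>)\<close>, by first-order linearization of \<open>inv G\<close>.  The Jacobian is taken at \<open>y\<close>,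
  which is the right point for centred noise.\<close>

definition ekf_pullback_mean ::
  "'a measure \<Rightarrow> (real^'n \<Rightarrow> real^'m) \<Rightarrow> real^'m \<Rightarrow> ('a \<Rightarrow> real^'m) \<Rightarrow> real^'n" where
  "ekf_pullback_mean M G y \<eta> = inv G (y - integral\<^sup>L M \<eta>)"

definition ekf_pullback_covariance ::
  "'a measure \<Rightarrow> (real^'n \<Rightarrow> real^'m) \<Rightarrow> real^'m \<Rightarrow> ('a \<Rightarrow> real^'m) \<Rightarrow> real^'n^'n" where
  "ekf_pullback_covariance M G y \<eta> =
     jacobian (inv G) (at y) ** covariance M \<eta> ** transpose (jacobian (inv G) (at y))"

end

(* Write D for the Jacobian of G at the fixed point, B = 2 C D^T for the predicted
   cross-covariance and K = 2 (D C D^T + S) for the predicted data covariance. The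
   covariance equation reads B K^-1 (2 D C) = C, and cancelling C shows that 2 D is a left
   inverse of the gain B K^-1. Hence the gain is injective, so the mean equation gives G m = y, and
   2 D B = K, which is D C D^T = S. The Jacobian of the inverse map at y is D^-1 by the
   chain rule, so it remains to see that a centred normal variable with the given
   density has mean 0 and covariance S; translation invariance of Lebesgue measure gives
   its moment generating function, and this determines the first two moments. *)

theory Submission
  imports Defs "HOL-Real_Asymp.Real_Asymp"
begin

section \<open>Matrix inverses and positive definiteness\<close>

lemma
  fixes A :: "'a::semiring_1^'n^'m"
  assumes "invertible A"
  shows matrix_inv_right: "A ** matrix_inv A = mat 1"
    and matrix_inv_left: "matrix_inv A ** A = mat 1"
  using someI_ex[OF assms[unfolded invertible_def]] by (simp_all add: matrix_inv_def)

lemma matrix_inv_unique: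
  fixes A B :: "real^'n^'n"
  assumes "A ** B = mat 1"
  shows "matrix_inv A = B"
proof -
  have "invertible A"
    using assms by (auto simp: invertible_right_inverse)
  then have "matrix_inv A ** (A ** B) = B"
    by (simp add: matrix_mul_assoc matrix_inv_left)
  then show ?thesis
    by (simp add: assms)
qed

lemma positive_definite_invertible:
  assumes "positive_definite A"
  shows "invertible A"
proof -
  have "x = 0" if "A *v x = 0" for x
    using assms that by (force simp: positive_definite_def)
  then show ?thesis
    by (simp add: invertible_left_inverse matrix_left_invertible_ker)
qed

lemma inner_matrix_congruence:
  fixes C :: "real^'n^'n" and D :: "real^'n^'m"
  shows "x \<bullet> ((D ** C ** transpose D) *v x) = (transpose D *v x) \<bullet> (C *v (transpose D *v x))"
  by (simp add: dot_lmul_matrix flip: matrix_vector_mul_assoc)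

text \<open>The congruence term is only semidefinite, as \<open>D\<close> may annihilate directions;
  strictness comes from \<open>S\<close>. This is what makes the predicted data covariance
  invertible.\<close>

lemma positive_definite_congruence_add:
  fixes C :: "real^'n^'n" and D :: "real^'n^'m"
  assumes "covariance_matrix C" "positive_definite S"
  shows "positive_definite (D ** C ** transpose D + S)"
proof -
  have "transpose (D ** C ** transpose D + S) = transpose (D ** C ** transpose D) + transpose S"
    by (simp add: transpose_def vec_eq_iff)
  then have "transpose (D ** C ** transpose D + S) = D ** C ** transpose D + S"
    using assms unfolding covariance_matrix_def positive_definite_def
    by (simp add: matrix_transpose_mul matrix_mul_assoc)
  then show ?thesis
    using assms unfolding covariance_matrix_def positive_definite_def
    by (simp add: matrix_vector_mult_add_rdistrib inner_add_right inner_matrix_congruence add_nonneg_pos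
        del: transpose_matrix_vector)
qed

section \<open>Mean and covariance of a normal vector\<close>

text \<open>Stated for a real variable so that it applies to every projection
  \<open>w \<bullet> (X \<omega> - \<mu>)\<close> of a normal vector, with \<open>v\<close> the
  value of the quadratic form of \<open>S\<close> at \<open>w\<close>.\<close>

lemma moments_of_normal_mgf:
  fixes X :: "'a \<Rightarrow> real" and v :: real
  assumes X: "X \<in> borel_measurable M"
    and int: "\<And>t. integrable M (\<lambda>\<omega>. exp (t * X \<omega>))"
    and mgf: "\<And>t. (\<integral>\<omega>. exp (t * X \<omega>) \<partial>M) = exp (t\<^sup>2 * v / 2)"
  shows "integrable M X" "(\<integral>\<omega>. X \<omega> \<partial>M) = 0"
    and "integrable M (\<lambda>\<omega>. (X \<omega>)\<^sup>2)" "(\<integral>\<omega>. (X \<omega>)\<^sup>2 \<partial>M) = v"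
proof -
  note X[measurable]
  txt \<open>Both moments are limits of combinations of \<open>exp (\<plusminus> X / N)\<close>, which have known integrals:
    \<open>X = lim N sinh (X / N)\<close> and \<open>X\<^sup>2 = lim 4 (N sinh (X / (2 N)))\<^sup>2\<close>. Since
    \<open>N \<bar>sinh (x / N)\<bar> \<le> \<bar>sinh x\<bar>\<close>, the limits may be taken under the integral.\<close>
  have sinh_mult_nonneg: "real n * sinh u \<le> sinh (real n * u)" if "u \<ge> 0" for n and u :: real
  proof (induction n)
    case (Suc n)
    have "real n * sinh u + sinh u \<le> sinh (real n * u) * cosh u + cosh (real n * u) * sinh u"
      using that mult_left_mono[OF cosh_real_ge_1, of "sinh (real n * u)" u]
        mult_right_mono[OF cosh_real_ge_1, of "sinh u" "real n * u"]
      by (intro add_mono order_trans[OF Suc]) simp_all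
    then show ?case
      by (simp add: distrib_right sinh_add algebra_simps)
  qed simp
  have sinh_mult: "real n * \<bar>sinh u\<bar> \<le> \<bar>sinh (real n * u)\<bar>" for n and u :: real
    using sinh_mult_nonneg[of "\<bar>u\<bar>" n] by (simp add: abs_mult flip: sinh_real_abs)
  \<comment> \<open>The shift avoids division by zero and makes the term at \<open>n = 0\<close> the
    dominating function: \<open>s 0 x = sinh x\<close>.\<close>
  define N where "N n = real (Suc n)" for n
  define s where "s n x = N n * sinh (x / N n)" for n x
  have s_le: "\<bar>s n x\<bar> \<le> \<bar>sinh x\<bar>" for n x
    using sinh_mult[of "Suc n" "x / N n"] by (simp add: s_def N_def abs_mult)
  have s_lim: "(\<lambda>n. s n x) \<longlonglongrightarrow> x" for x
    unfolding s_def N_def sinh_def real_scaleR_def by real_asymp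
  \<comment> \<open>The halved argument serves the identity 4 sinh(u/2)^2 = 2 (cosh u - 1):
    \<open>q\<close> becomes linear in exponentials at plus and minus 1/N, so its integral is again
    known.\<close>
  define q where "q n x = 4 * (s n (x / 2))\<^sup>2" for n x
  have q_eq: "q n x = (N n)\<^sup>2 * (exp (1 / N n * x) + exp (- (1 / N n * x)) - 2)" for n x
  proof -
    have "q n x = 2 * (N n)\<^sup>2 * (cosh (2 * (x / 2 / N n)) - 1)"
      unfolding cosh_double_cosh by (simp add: q_def s_def power_mult_distrib sinh_square_eq)
    then show ?thesis
      by (simp add: cosh_def field_simps)
  qed
  have s_eq: "s n x = N n / 2 * (exp (1 / N n * x) - exp (- (1 / N n * x)))" for n x
    by (simp add: s_def sinh_def)
  have mgf_neg: "integrable M (\<lambda>\<omega>. exp (- (t * X \<omega>)))"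
      "(\<integral>\<omega>. exp (- (t * X \<omega>)) \<partial>M) = exp (t\<^sup>2 * v / 2)" for t
    using int[of "-t"] mgf[of "-t"] by simp_all
  \<comment> \<open>At \<open>t = 0\<close> the hypotheses say that \<open>M\<close> has total mass
    1, which evaluates the constant term of \<open>q\<close>.\<close>
  have one: "integrable M (\<lambda>_. 1::real)" "measure M (space M) = 1"
    using int[of 0] mgf[of 0] by simp_all
  have const: "integrable M (\<lambda>_. 2::real)"
    using integrable_mult_right[OF one(1), of 2] by simp
  have dom1: "integrable M (\<lambda>\<omega>. \<bar>sinh (X \<omega>)\<bar>)"
    using int[of 1] int[of "-1"] unfolding sinh_def by simp
  have q_le: "\<bar>q n x\<bar> \<le> \<bar>q 0 x\<bar>" for n x
    using s_le[of n "x/2"] by (simp add: q_def s_def[of 0] N_def[of 0] abs_le_square_iff)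
  have dom2: "integrable M (\<lambda>\<omega>. \<bar>q 0 (X \<omega>)\<bar>)"
    unfolding q_eq using int[of 1] int[of "-1"] const
    by (intro integrable_abs) (simp add: N_def)
  \<comment> \<open>The two exponentials cancel because the generating function is even in
    \<open>t\<close>.\<close>
  have ints: "(\<integral>\<omega>. s n (X \<omega>) \<partial>M) = 0" for n
    unfolding s_eq by (simp add: int mgf mgf_neg del: times_divide_eq_left)
  have intq: "(\<integral>\<omega>. q n (X \<omega>) \<partial>M) = (N n)\<^sup>2 * (2 * exp ((1 / N n)\<^sup>2 * v / 2) - 2)" for n
    unfolding q_eq
    by (simp add: int mgf mgf_neg const one(2) del: times_divide_eq_left)
  have [measurable]: "(\<lambda>\<omega>. s n (X \<omega>)) \<in> borel_measurable M"
     "(\<lambda>\<omega>. q n (X \<omega>)) \<in> borel_measurable M" for n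
    unfolding q_eq s_eq by measurable
  have q_lim: "(\<lambda>n. q n x) \<longlonglongrightarrow> x\<^sup>2" for x
    unfolding q_def using s_lim[of "x/2"] by (auto intro!: tendsto_eq_intros simp: power2_eq_square)
  show "integrable M X"
    by (rule integrable_dominated_convergence[OF X _ dom1, where s = "\<lambda>n \<omega>. s n (X \<omega>)"]) (auto simp: s_lim s_le)
  have "(\<lambda>n. \<integral>\<omega>. s n (X \<omega>) \<partial>M) \<longlonglongrightarrow> (\<integral>\<omega>. X \<omega> \<partial>M)"
    by (rule integral_dominated_convergence[OF X _ dom1, where s = "\<lambda>n \<omega>. s n (X \<omega>)"]) (auto simp: s_lim s_le)
  then show "(\<integral>\<omega>. X \<omega> \<partial>M) = 0"
    by (simp add: ints LIMSEQ_const_iff)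
  show "integrable M (\<lambda>\<omega>. (X \<omega>)\<^sup>2)"
    by (rule integrable_dominated_convergence[OF _ _ dom2, where s = "\<lambda>n \<omega>. q n (X \<omega>)"]) (auto simp: q_lim q_le)
  have "(\<lambda>n. \<integral>\<omega>. q n (X \<omega>) \<partial>M) \<longlonglongrightarrow> (\<integral>\<omega>. (X \<omega>)\<^sup>2 \<partial>M)"
    by (rule integral_dominated_convergence[OF _ _ dom2, where s = "\<lambda>n \<omega>. q n (X \<omega>)"]) (auto simp: q_lim q_le)
  \<comment> \<open>First-order expansion of the exponential: 2 N^2 (exp(v / (2 N^2)) - 1) tends to
    v.\<close>
  moreover have "(\<lambda>n. \<integral>\<omega>. q n (X \<omega>) \<partial>M) \<longlonglongrightarrow> v"
    unfolding intq N_def by real_asymp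
  ultimately show "(\<integral>\<omega>. (X \<omega>)\<^sup>2 \<partial>M) = v"
    by (rule LIMSEQ_unique)
qed

lemma multivariate_normal_mgf:
  fixes X :: "'a \<Rightarrow> real^'n"
  assumes "multivariate_normal M X \<mu> S"
  shows "integrable M (\<lambda>\<omega>. exp (w \<bullet> (X \<omega> - \<mu>)))"
    and "(\<integral>\<omega>. exp (w \<bullet> (X \<omega> - \<mu>)) \<partial>M) = exp (w \<bullet> (S *v w) / 2)"
proof -
  define f where "f = multivariate_normal_density \<mu> S"
  define P where "P = matrix_inv S"
  have pd: "positive_definite S" and D: "distributed M lborel X (\<lambda>x. ennreal (f x))"
    using assms by (simp_all add: multivariate_normal_def f_def)
  interpret prob_space M
    using assms by (simp add: multivariate_normal_def)
  have S: "transpose S = S" and inv: "S ** P = mat 1" "P ** S = mat 1"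
    using pd positive_definite_invertible[OF pd]
    by (simp_all add: positive_definite_def P_def matrix_inv_right matrix_inv_left)
  have one: "(\<integral>\<^sup>+x. ennreal (f x) \<partial>lborel) = 1"
    using distributed_nn_integral[OF D, of "\<lambda>_. 1"] by (simp add: emeasure_space_1)
  define k where "k = sqrt ((2 * pi) ^ CARD('n) * det S)"
  have f: "f x = exp (- ((x - \<mu>) \<bullet> (P *v (x - \<mu>))) / 2) / k" for x
    by (simp add: f_def multivariate_normal_density_def P_def k_def)
  \<comment> \<open>Positivity of the determinant is read off the normalization. If \<open>k\<close>
    were negative, or zero with division by zero giving 0, then \<open>f\<close> would be
    nonpositive and \<open>ennreal\<close> would truncate it to 0, against total mass 1.\<close>
  have "k > 0"
  proof (rule ccontr)
    assume "\<not> k > 0"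
    then have "ennreal (f x) = 0" for x
      by (simp add: f ennreal_eq_0_iff divide_nonneg_nonpos)
    with one show False by simp
  qed
  then have nonneg: "f x \<ge> 0" for x
    by (simp add: f)
  have [measurable]: "f \<in> borel_measurable borel"
    using distributed_real_measurable[OF _ D] nonneg by simp
  have int: "integrable lborel f" and total: "(\<integral>x. f x \<partial>lborel) = 1"
    using one nonneg by (simp_all add: integrableI_nn_integral_finite[where x=1] integral_eq_nn_integral)
  define a where "a = - (S *v w)"
  txt \<open>Completing the square: exponential tilting of a normal density is a translation.\<close>
  have shift: "f x * exp (w \<bullet> (x - \<mu>)) = exp (w \<bullet> (S *v w) / 2) * f (a + x)" for x
  proof -
    define z where "z = x - \<mu>"
    have Pa: "P *v (S *v w) = w"
      by (simp add: matrix_vector_mul_assoc inv)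
    have "(S *v w) \<bullet> (P *v z) = w \<bullet> z"
      using S inv(1) by (metis dot_lmul_matrix matrix_vector_mul_assoc matrix_vector_mul_lid transpose_matrix_vector)
    then have "- ((z - S *v w) \<bullet> (P *v (z - S *v w))) / 2
      = - (z \<bullet> (P *v z)) / 2 + w \<bullet> z - w \<bullet> (S *v w) / 2"
      by (simp add: matrix_vector_mult_diff_distrib Pa inner_diff_left inner_diff_right inner_commute
          field_simps)
    moreover have "f x * exp (w \<bullet> (x - \<mu>)) = exp (- (z \<bullet> (P *v z)) / 2 + w \<bullet> z) / k"
      by (simp add: f z_def flip: exp_add)
    moreover have "a + x - \<mu> = z - S *v w"
      by (simp add: a_def z_def)
    ultimately show ?thesis
      by (simp add: f flip: exp_add)
  qed
  have trans: "integrable lborel (\<lambda>x. f (a + x))" "(\<integral>x. f (a + x) \<partial>lborel) = 1"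
    using int total integrable_distr_eq[of "(+) a" lborel borel f] integral_distr[of "(+) a" lborel borel f]
    by (simp_all add: lborel_distr_plus)
  have m: "(\<lambda>x. exp (w \<bullet> (x - \<mu>))) \<in> borel_measurable lborel"
    by simp
  have "integrable lborel (\<lambda>x. f x * exp (w \<bullet> (x - \<mu>)))"
    using trans by (simp add: shift)
  then show "integrable M (\<lambda>\<omega>. exp (w \<bullet> (X \<omega> - \<mu>)))"
    using distributed_integrable[OF D m] nonneg by simp
  show "(\<integral>\<omega>. exp (w \<bullet> (X \<omega> - \<mu>)) \<partial>M) = exp (w \<bullet> (S *v w) / 2)"
    using distributed_integral[OF D m] nonneg trans by (simp add: shift)
qed

lemma
  fixes X :: "'a \<Rightarrow> real^'n"
  assumes N: "multivariate_normal M X \<mu> S"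
  shows multivariate_normal_mean: "integral\<^sup>L M X = \<mu>"
    and multivariate_normal_covariance: "covariance M X = S"
proof -
  interpret prob_space M
    using N by (simp add: multivariate_normal_def)
  have X [measurable]: "X \<in> borel_measurable M"
    using N by (auto simp: multivariate_normal_def dest: distributed_measurable)
  have S: "transpose S = S"
    using N by (simp add: multivariate_normal_def positive_definite_def)
  have meas: "(\<lambda>\<omega>. w \<bullet> (X \<omega> - \<mu>)) \<in> borel_measurable M" for w
    by measurable
  have int: "integrable M (\<lambda>\<omega>. exp (t * (w \<bullet> (X \<omega> - \<mu>))))" for t w
    using multivariate_normal_mgf(1)[OF N, of "t *\<^sub>R w"] by simp
  have mgf: "(\<integral>\<omega>. exp (t * (w \<bullet> (X \<omega> - \<mu>))) \<partial>M) = exp (t\<^sup>2 * (w \<bullet> (S *v w)) / 2)" for t w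
    using multivariate_normal_mgf(2)[OF N, of "t *\<^sub>R w"]
    by (simp add: matrix_vector_mult_scaleR power2_eq_square mult.assoc)
  note moments = moments_of_normal_mgf[OF meas int mgf]
  have comp: "integrable M (\<lambda>\<omega>. (X \<omega> - \<mu>) $ i)" "(\<integral>\<omega>. (X \<omega> - \<mu>) $ i \<partial>M) = 0" for i
    using moments(1,2)[of "axis i 1"] by (simp_all add: inner_axis')
  \<comment> \<open>Coordinates can be pulled out of the vector integral once the vector itself is
    known to be integrable; the basis expansion assembles this from the coordinates.\<close>
  have "integrable M (\<lambda>\<omega>. \<Sum>i\<in>UNIV. (X \<omega> - \<mu>) $ i *\<^sub>R axis i (1::real))"
    using comp(1) by (intro Bochner_Integration.integrable_sum integrable_scaleR_left) auto
  then have int_X: "integrable M (\<lambda>\<omega>. X \<omega> - \<mu>)"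
    by (simp only: basis_expansion flip: scalar_mult_eq_scaleR)
  have "integral\<^sup>L M (\<lambda>\<omega>. X \<omega> - \<mu>) $ i = 0" for i
    using integral_inner_left[OF int_X, of "axis i 1"] comp(2)[of i] by (simp add: inner_axis)
  then have "integral\<^sup>L M (\<lambda>\<omega>. X \<omega> - \<mu>) = 0"
    by (simp add: vec_eq_iff)
  moreover have "integrable M (\<lambda>\<omega>. (X \<omega> - \<mu>) + \<mu>)"
    by (intro Bochner_Integration.integrable_add int_X) simp
  ultimately show mean: "integral\<^sup>L M X = \<mu>"
    by (simp add: prob_space)
  have "(\<integral>\<omega>. (X \<omega> - \<mu>) $ i * (X \<omega> - \<mu>) $ j \<partial>M) = S $ i $ j" for i j
  proof -
    \<comment> \<open>Polarization: only second moments of single projections are known, and the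
      product of two coordinates is a difference of two such squares. Symmetry of \<open>S\<close>
      then merges the two mixed entries.\<close>
    define p q :: "real^'n" where "p = axis i 1 + axis j 1" and "q = axis i 1 - axis j 1"
    have "(X \<omega> - \<mu>) $ i * (X \<omega> - \<mu>) $ j
        = ((p \<bullet> (X \<omega> - \<mu>))\<^sup>2 - (q \<bullet> (X \<omega> - \<mu>))\<^sup>2) / 4" for \<omega>
      by (simp add: p_def q_def inner_add_left inner_diff_left inner_axis' power2_eq_square algebra_simps)
    then have "(\<integral>\<omega>. (X \<omega> - \<mu>) $ i * (X \<omega> - \<mu>) $ j \<partial>M)
        = (p \<bullet> (S *v p) - q \<bullet> (S *v q)) / 4"
      by (simp only:) (simp add: moments(3,4))
    also have "\<dots> = (S $ i $ j + S $ j $ i) / 2"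
    proof -
      have "axis k 1 \<bullet> (S *v axis l 1) = S $ k $ l" for k l
        by (simp add: inner_axis' matrix_vector_mult_basis column_def)
      then show ?thesis
        by (simp add: p_def q_def matrix_vector_right_distrib matrix_vector_mult_diff_distrib
            inner_add_left inner_diff_left inner_add_right inner_diff_right)
    qed
    also have "S $ j $ i = S $ i $ j"
      using arg_cong[OF S, of "\<lambda>A. A $ i $ j"] by (simp add: transpose_def)
    finally show ?thesis by simp
  qed
  then show "covariance M X = S"
    by (simp add: covariance_def mean vec_eq_iff)
qed

section \<open>The Jacobian of the inverse map and the fixed-point equations\<close>

text \<open>Chain rule for \<open>inv G \<circ> G = id\<close>. A left inverse of the Jacobian is
  all that the pull-back covariance uses.\<close>

lemma jacobian_inv_mult_jacobian:
  fixes G :: "real^'n \<Rightarrow> real^'m"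
  assumes "inj G" "G differentiable (at x)" "inv G differentiable (at (G x))"
  shows "jacobian (inv G) (at (G x)) ** jacobian G (at x) = mat 1"
proof -
  have "((inv G \<circ> G) has_derivative
      (\<lambda>h. jacobian (inv G) (at (G x)) *v h) \<circ> (\<lambda>h. jacobian G (at x) *v h)) (at x)"
    using assms by (intro diff_chain_at) (simp_all flip: jacobian_works)
  moreover have "inv G \<circ> G = id"
    using assms by simp
  moreover have "(id has_derivative id) (at x)"
    by (simp add: id_def)
  ultimately have "(\<lambda>h. jacobian (inv G) (at (G x)) *v h) \<circ> (\<lambda>h. jacobian G (at x) *v h) = id"
    by (metis has_derivative_unique)
  then show ?thesis
    by (simp add: matrix_eq matrix_vector_mul_assoc fun_eq_iff)
qed

lemma
  fixes G :: "real^'n \<Rightarrow> real^'n"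
  assumes S: "positive_definite S"
    and stat: "exki_stationary G y S m C"
    and C: "invertible C"
  shows exki_stationary_mean: "G m = y"
    and exki_stationary_covariance:
      "jacobian G (at m) ** C ** transpose (jacobian G (at m)) = S"
proof -
  define D where "D = jacobian G (at m)"
  define A where "A = D ** C ** transpose D"
  define B where "B = 2 *\<^sub>R (C ** transpose D)"
  define K where "K = 2 *\<^sub>R (A + S)"
  have cov: "covariance_matrix C" and step: "exki_step G y S (m, C) = (m, C)"
    using stat by (simp_all add: exki_stationary_def)
  have "transpose C = C"
    using cov by (simp add: covariance_matrix_def)
  then have Bt: "transpose B = 2 *\<^sub>R D ** C"
    by (simp add: B_def transpose_scalar matrix_transpose_mul matrix_scalar_ac flip: scalar_matrix_assoc)
  have B: "(C + C) ** transpose D = B"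
    by (simp add: B_def flip: scaleR_2 scalar_matrix_assoc)
  have K: "D ** (C + C) ** transpose D + 2 *\<^sub>R S = K"
    by (simp add: K_def A_def matrix_scalar_ac scaleR_add_right flip: scaleR_2 scalar_matrix_assoc)
  have "exki_step G y S (m, C)
      = (m + (B ** matrix_inv K) *v (y - G m), C + C - B ** matrix_inv K ** transpose B)"
    by (simp only: exki_step_def ekf_step_def Let_def prod.case B K flip: D_def)
  with step have eq1: "(B ** matrix_inv K) *v (y - G m) = 0"
    and eq2: "B ** matrix_inv K ** transpose B = C"
    by (simp_all add: algebra_simps del: mult_2 mult_2_right)
  \<comment> \<open>By \<open>Bt\<close>, the covariance equation ends in a factor \<open>C\<close>,
    which multiplication by \<open>matrix_inv C\<close> on the right removes.\<close>
  have "(B ** matrix_inv K ** (2 *\<^sub>R D)) ** (C ** matrix_inv C) = C ** matrix_inv C"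
    using eq2 by (simp only: Bt matrix_mul_assoc)
  then have "B ** matrix_inv K ** (2 *\<^sub>R D) = mat 1"
    by (simp add: matrix_inv_right[OF C])
  then have left: "2 *\<^sub>R D ** (B ** matrix_inv K) = mat 1"
    by (rule matrix_left_right_inverse[THEN iffD1])
  then have "y - G m = (2 *\<^sub>R D) *v ((B ** matrix_inv K) *v (y - G m))"
    by (simp add: matrix_vector_mul_assoc)
  then show "G m = y"
    by (simp add: eq1)
  \<comment> \<open>This makes \<open>matrix_inv K\<close> a genuine inverse, so that it can be
    cancelled from the gain.\<close>
  have "invertible K"
    unfolding K_def A_def
    by (intro scalar_invertible positive_definite_invertible positive_definite_congruence_add cov S) simp
  then have "2 *\<^sub>R D ** B = 2 *\<^sub>R D ** (B ** matrix_inv K) ** K"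
    by (simp add: matrix_inv_left flip: matrix_mul_assoc)
  then have "2 *\<^sub>R D ** B = K"
    by (simp add: left)
  \<comment> \<open>The hyperparameters are tuned for this balance: 4 \<open>A\<close> on one side
    and 2 \<open>A\<close> + 2 \<open>S\<close> on the other leave exactly
    \<open>A = S\<close>.\<close>
  moreover have "2 *\<^sub>R D ** B = 4 *\<^sub>R A"
    by (simp add: B_def A_def matrix_scalar_ac matrix_mul_assoc flip: scalar_matrix_assoc)
  ultimately have "4 *\<^sub>R A = 2 *\<^sub>R A + 2 *\<^sub>R S"
    by (simp add: K_def scaleR_add_right)
  then have "A = S"
    by (simp add: vec_eq_iff)
  then show "jacobian G (at m) ** C ** transpose (jacobian G (at m)) = S"
    by (simp add: A_def D_def)
qed

theorem theorem3p6:
  fixes G :: "real^'n \<Rightarrow> real^'n"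
    and y m :: "real^'n"
    and S\<^sub>\<eta> C :: "real^'n^'n"
    and M :: "'a measure"
    and \<eta> :: "'a \<Rightarrow> real^'n"
  assumes "bij G"
    and "positive_definite S\<^sub>\<eta>"
    and "exki_stationary G y S\<^sub>\<eta> m C"
    and "G differentiable (at m)"
    and "invertible (jacobian G (at m))"
    and "invertible C"
  shows "m = inv G y
    \<and> matrix_inv C = transpose (jacobian G (at m)) ** matrix_inv S\<^sub>\<eta> ** jacobian G (at m)
    \<and> (multivariate_normal M \<eta> 0 S\<^sub>\<eta> \<and> inv G differentiable (at y) \<longrightarrow>
         m = ekf_pullback_mean M G y \<eta> \<and> C = ekf_pullback_covariance M G y \<eta>)"
proof -
  define D where "D = jacobian G (at m)"
  note y = exki_stationary_mean[OF assms(2,3,6)]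
  have S: "D ** C ** transpose D = S\<^sub>\<eta>"
    unfolding D_def by (rule exki_stationary_covariance[OF assms(2,3,6)])
  have "inj G"
    using assms(1) by (rule bij_is_inj)
  then have m: "m = inv G y"
    by (simp flip: y)
  \<comment> \<open>Square factors of the identity commute; swapping them twice isolates
    \<open>C\<close> as the left factor.\<close>
  have "(D ** C) ** (transpose D ** matrix_inv S\<^sub>\<eta>) = mat 1"
    by (simp add: matrix_mul_assoc S matrix_inv_right positive_definite_invertible[OF assms(2)])
  then have "(transpose D ** matrix_inv S\<^sub>\<eta>) ** (D ** C) = mat 1"
    by (rule matrix_left_right_inverse[THEN iffD1])
  then have "C ** (transpose D ** matrix_inv S\<^sub>\<eta> ** D) = mat 1"
    by (subst matrix_left_right_inverse) (simp add: matrix_mul_assoc)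
  then have precision: "matrix_inv C = transpose D ** matrix_inv S\<^sub>\<eta> ** D"
    by (rule matrix_inv_unique)
  \<comment> \<open>Substituting \<open>S\<close> for \<open>S\<^sub>\<eta>\<close> pairs each
    \<open>J\<close> with a \<open>D\<close>. The relevant \<open>J\<close> is the Jacobian of
    \<open>inv G\<close> at \<open>y = G m\<close>.\<close>
  have "C = J ** S\<^sub>\<eta> ** transpose J" if "J ** D = mat 1" for J
  proof -
    have "J ** S\<^sub>\<eta> ** transpose J = (J ** D) ** C ** transpose (J ** D)"
      by (simp add: matrix_transpose_mul matrix_mul_assoc flip: S)
    then show ?thesis
      by (simp add: that)
  qed
  then have "C = ekf_pullback_covariance M G y \<eta>"
    if "multivariate_normal M \<eta> 0 S\<^sub>\<eta>" "inv G differentiable (at y)"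
    using jacobian_inv_mult_jacobian[OF \<open>inj G\<close> assms(4)] that
    by (simp add: ekf_pullback_covariance_def multivariate_normal_covariance[OF that(1)] y D_def)
  moreover have "m = ekf_pullback_mean M G y \<eta>" if "multivariate_normal M \<eta> 0 S\<^sub>\<eta>"
    by (simp add: ekf_pullback_mean_def multivariate_normal_mean[OF that] m)
  ultimately show ?thesis
    using m precision by (simp add: D_def)
qed

end
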